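(* Let $d_1,d_2,d_3$ be positive integers and $r\ge 0$ an integer with $d_1+d_2+d_3=r+3$. Let $F(x_1,x_2,x_3)$ be the coefficient of $H_1^{d_1}H_2^{d_2}H_3^{d_3}$ in the formal product $$P=(x_1H_1+x_2H_2+x_3H_3)^3\prod_{j=1}^r(a_jH_1+b_jH_2+c_jH_3),$$ and let $B_{pq}$ ($1\le p,q\le 3$) be the cofactors of the Hessian matrix $(\partial^2F/\partial x_i\partial x_j)_{1\le i,j\le 3}$. Regard each $B_{pq}$ as a polynomial in the variables $a_j,b_j,c_j$ ($1\le j\le r$) and $x_1,x_2,x_3$. Then for every $p$, the polynomial $B_{pp}$ has only negative coefficients (i.e. every nonzero coefficient is negative), and for all $p\neq q$, the polynomial $B_{pq}$ has only positive coefficients (i.e. every nonzero coefficient is positive).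
   Context: Here $H_1,H_2,H_3$, $x_1,x_2,x_3$ and $a_j,b_j,c_j$ ($1\le j\le r$) are commuting indeterminates; the product is empty (equal to $1$) when $r=0$. Thus $F$ is a cubic form in $x_1,x_2,x_3$ whose coefficients are polynomials in the $a_j,b_j,c_j$. The cofactors are signed: writing $F_{ij}=\partial^2F/\partial x_i\partial x_j$, the matrix $(B_{pq})$ is the adjugate of the symmetric matrix $(F_{ij})$; e.g. $B_{33}=F_{11}F_{22}-F_{12}^2$ and $B_{12}=F_{13}F_{23}-F_{12}F_{33}$. *)

theory Defs
  imports "HOL-Library.Poly_Mapping" "Jordan_Normal_Form.Determinant"
begin

text \<open>Multivariate polynomials over \<open>'a\<close> in the indeterminates \<open>'v\<close>, with the convolution product
  of \<open>Poly_Mapping\<close>; \<open>Poly_Mapping.lookup p m\<close> is the coefficient of the monomial \<open>m\<close>.\<close>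

type_synonym ('v, 'a) mpoly = "('v \<Rightarrow>\<^sub>0 nat) \<Rightarrow>\<^sub>0 'a"

definition Var :: "'v \<Rightarrow> ('v, 'a::comm_semiring_1) mpoly" where
  "Var v = Poly_Mapping.single (Poly_Mapping.single v 1) 1"

definition Const :: "'a \<Rightarrow> ('v, 'a::comm_semiring_1) mpoly" where
  "Const k = Poly_Mapping.single 0 k"

text \<open>The subtraction of monomials is truncated; a monomial \<open>m\<close> free of \<open>v\<close> contributes nothing
  since its factor \<open>lookup m v\<close> vanishes.\<close>

definition partial_deriv :: "'v \<Rightarrow> ('v, 'a::comm_semiring_1) mpoly \<Rightarrow> ('v, 'a) mpoly" where
  "partial_deriv v p =
     (\<Sum>m\<in>Poly_Mapping.keys p.
        Poly_Mapping.single (m - Poly_Mapping.single v 1)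
          (of_nat (Poly_Mapping.lookup m v) * Poly_Mapping.lookup p m))"

datatype indet = X nat | A nat | B nat | C nat

text \<open>\<open>P\<close> is a polynomial in \<open>H\<^sub>1, H\<^sub>2, H\<^sub>3\<close> (indeterminates indexed by \<open>1, 2, 3\<close>) whose
  coefficients are integer polynomials in the remaining indeterminates.\<close>

definition P_poly :: "nat \<Rightarrow> (nat, (indet, int) mpoly) mpoly" where
  "P_poly r =
     (Const (Var (X 1)) * Var 1 + Const (Var (X 2)) * Var 2 + Const (Var (X 3)) * Var 3) ^ 3 *
     (\<Prod>j = 1..r. Const (Var (A j)) * Var 1 + Const (Var (B j)) * Var 2 + Const (Var (C j)) * Var 3)"

definition F_poly :: "nat \<Rightarrow> nat \<Rightarrow> nat \<Rightarrow> nat \<Rightarrow> (indet, int) mpoly" where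
  "F_poly r d1 d2 d3 =
     Poly_Mapping.lookup (P_poly r)
       (Poly_Mapping.single 1 d1 + Poly_Mapping.single 2 d2 + Poly_Mapping.single 3 d3)"

text \<open>Matrices are indexed from \<open>0\<close>, the indeterminates \<open>X i\<close> from \<open>1\<close>.\<close>

definition hessian :: "(indet, int) mpoly \<Rightarrow> (indet, int) mpoly mat" where
  "hessian F = mat 3 3 (\<lambda>(i, j). partial_deriv (X (i + 1)) (partial_deriv (X (j + 1)) F))"

definition hessian_cofactor :: "(indet, int) mpoly \<Rightarrow> nat \<Rightarrow> nat \<Rightarrow> (indet, int) mpoly" where
  "hessian_cofactor F p q = cofactor (hessian F) (p - 1) (q - 1)"

definition only_negative_coeffs :: "('v, 'a::linordered_idom) mpoly \<Rightarrow> bool" where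
  "only_negative_coeffs p \<longleftrightarrow> (\<forall>m\<in>Poly_Mapping.keys p. Poly_Mapping.lookup p m < 0)"

definition only_positive_coeffs :: "('v, 'a::linordered_idom) mpoly \<Rightarrow> bool" where
  "only_positive_coeffs p \<longleftrightarrow> (\<forall>m\<in>Poly_Mapping.keys p. Poly_Mapping.lookup p m > 0)"

end

theory Submission imports Defs begin

text \<open>
  Let \<open>E(i, j, k)\<close> be the coefficient of \<open>H\<^sub>1\<^sup>i H\<^sub>2\<^sup>j H\<^sub>3\<^sup>k\<close> in the product of \<open>n = r + 1\<close> linear forms:
  the \<open>r\<close> given ones and \<open>x\<^sub>1 H\<^sub>1 + x\<^sub>2 H\<^sub>2 + x\<^sub>3 H\<^sub>3\<close>. Differentiating \<open>P\<close> with respect to \<open>x\<^sub>p\<close>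
  replaces one of the three equal factors by \<open>H\<^sub>p\<close>, so each second derivative of \<open>F\<close> is \<open>6\<close> times an
  \<open>E\<close> whose index is \<open>(d\<^sub>1, d\<^sub>2, d\<^sub>3)\<close> lowered by one in two (possibly equal) places. Up to the
  factor \<open>36\<close> and the order of the indices there are then only two kinds of cofactors:

    \<^item> \<open>E(i-2, j, k) E(i, j-2, k) - E(i-1, j-1, k)\<^sup>2\<close> on the diagonal,
    \<^item> \<open>E(i-1, j, k-1) E(i, j-1, k-1) - E(i-1, j-1, k) E(i, j, k-2)\<close> off the diagonal.

  In a product \<open>E(u) E(v)\<close> every linear form contributes an unordered pair of indices: a loop at
  a vertex, or an edge, of the triangle with vertices \<open>1, 2, 3\<close>. Fixing these pairs fixes a monomial;
  its multiplicity is the number of ways to orient the edges so that the first ends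
  have the multidegree \<open>u\<close> and the second ends \<open>v\<close> (\<open>form_coeff_mult\<close>). If \<open>u + v\<close> is
  the degree sequence of this multigraph (otherwise there are none), an orientation is counted
  exactly when the net flow out of each vertex is given by \<open>u - v\<close>. If \<open>W\<^sub>m(s)\<close> is
  the number of \<open>\<plusminus>1\<close> walks of length \<open>m\<close> from \<open>0\<close> to \<open>s\<close>, and the three sides of the triangle carry
  \<open>a, b, c\<close> edges, the multiplicity is a sum over the flow \<open>q\<close> through the third side
  (\<open>splittings_eq_flows\<close>):
  \<open>\<Sum>\<^sub>q W\<^sub>a(q + x) W\<^sub>b(q + x + y) W\<^sub>c(q)\<close>, where \<open>x\<close> and \<open>y\<close> are the net flows out of the vertices \<open>1\<close> and \<open>2\<close>.

  It remains to compare such sums. Since \<open>W\<^sub>m\<close> is even, reflecting \<open>q\<close> turns twice the difference of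
  the two multiplicities into a single sum
  \<open>\<Sum>\<^sub>s u(s) (f(s-1) - f(s+1)) (g(s-1) - g(s+1))\<close>, with \<open>u = 1\<close>, \<open>f = W\<^sub>a\<close>, \<open>g = W\<^sub>b W\<^sub>c\<close> for a diagonal
  cofactor and \<open>u = W\<^sub>a\<close>, \<open>f = W\<^sub>b\<close>, \<open>g = W\<^sub>c\<close> for an off-diagonal one. As \<open>W\<^sub>m\<close> is also
  unimodal on each parity class, \<open>f(s-1) - f(s+1)\<close> is zero or has the sign of \<open>s\<close>, and the
  same holds for \<open>g(s-1) - g(s+1)\<close>: every term is nonnegative.
\<close>

section \<open>Counting walks on the integers\<close>

text \<open>Below, \<open>\<Sum>\<close> without a range denotes the sum of a finitely supported function.\<close>

no_notation suminf (binder "\<Sum>" 10)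

text \<open>\<open>walks n s\<close> counts the sequences of \<open>n\<close> signs with sum \<open>s\<close>, that is, the orientations of \<open>n\<close>
  parallel edges that carry a net flow \<open>s\<close>.\<close>

primrec walks :: "nat \<Rightarrow> int \<Rightarrow> int" where
  "walks 0 s = (if s = 0 then 1 else 0)"
| "walks (Suc n) s = walks n (s - 1) + walks n (s + 1)"

lemma walks_nonneg: "walks n s \<ge> 0"
  by (induction n arbitrary: s) auto

lemma walks_minus [simp]: "walks n (- s) = walks n s"
proof (induction n arbitrary: s)
  case (Suc n)
  show ?case
    using Suc[of "s + 1"] Suc[of "s - 1"] by simp
qed simp

lemma walks_eq_0: "\<bar>s\<bar> > int n \<Longrightarrow> walks n s = 0"
  by (induction n arbitrary: s) auto

lemma finite_walks: "finite {s. walks n s \<noteq> 0}"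
proof (rule finite_subset)
  show "{s. walks n s \<noteq> 0} \<subseteq> {- int n..int n}"
    using walks_eq_0[of n] by (force simp: not_less)
qed simp

text \<open>By the recursion the difference is \<open>walks (n - 1) (s - 1) - walks (n - 1) (s + 3)\<close>, two decreasing
  steps of a shorter walk. The case \<open>s = - 1\<close>, where the two
  sides are equal by symmetry, has to be included because the induction reaches it from \<open>s = 0\<close>.\<close>

lemma walks_decreasing: "s \<ge> - 1 \<Longrightarrow> walks n (s + 2) \<le> walks n s"
proof (induction n arbitrary: s)
  case (Suc n)
  show ?case
  proof (cases "s = - 1")
    case True
    then show ?thesis using walks_minus[of "Suc n" 1] by (simp del: walks.simps walks_minus)
  next
    case False
    then have "walks n (s + 3) \<le> walks n (s + 1)" "walks n (s + 1) \<le> walks n (s - 1)"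
      using Suc.IH[of "s + 1"] Suc.IH[of "s - 1"] Suc.prems by (simp_all add: algebra_simps)
    then show ?thesis by (simp add: algebra_simps)
  qed
qed auto

lemma walks_step_sign:
  "s \<ge> 0 \<Longrightarrow> walks n (s + 1) \<le> walks n (s - 1)"
  "s \<le> 0 \<Longrightarrow> walks n (s - 1) \<le> walks n (s + 1)"
proof -
  show "walks n (s + 1) \<le> walks n (s - 1)" if "s \<ge> 0"
    using walks_decreasing[of "s - 1" n] that by (simp add: algebra_simps)
  show "walks n (s - 1) \<le> walks n (s + 1)" if "s \<le> 0"
  proof -
    have "- s - 1 = - (s + 1)" "- s - 1 + 2 = - (s - 1)" by simp_all
    then show ?thesis
      using walks_decreasing[of "- s - 1" n] that by (simp only: walks_minus)
  qed
qed

section \<open>Orientations of a multigraph on a triangle\<close>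

text \<open>The number of orientations of a triangle with \<open>a\<close> edges between the vertices \<open>1, 2\<close>, \<open>b\<close> between
  \<open>2, 3\<close> and \<open>c\<close> between \<open>3, 1\<close> for which the net flows out of the vertices \<open>1, 2, 3\<close> are \<open>x\<close>, \<open>y\<close> and
  \<open>- x - y\<close>. Conservation at the vertices \<open>1\<close> and \<open>2\<close> expresses the flows along the sides in terms
  of the flow \<open>q\<close> from \<open>3\<close> to \<open>1\<close>.\<close>

definition flows :: "nat \<Rightarrow> nat \<Rightarrow> nat \<Rightarrow> int \<Rightarrow> int \<Rightarrow> int" where
  "flows a b c x y = (\<Sum>q. walks a (q + x) * walks b (q + x + y) * walks c q)"

lemma finite_walks_mult: "finite {s. f s * walks n (s + k) \<noteq> 0}"
proof (rule finite_subset)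
  show "{s. f s * walks n (s + k) \<noteq> 0} \<subseteq> (\<lambda>s. s - k) ` {s. walks n s \<noteq> 0}"
    by (auto intro!: image_eqI[where x = "_ + k"])
qed (simp add: finite_walks)

lemma finite_walks_mult': "finite {s. f s * walks n (s - k) \<noteq> 0}" "finite {s. f s * walks n s \<noteq> 0}"
  using finite_walks_mult[of f n "- k"] finite_walks_mult[of f n 0] by simp_all

lemma Sum_any_shift: "Sum_any f = (\<Sum>s. f (s + k :: int))"
  by (rule Sum_any.reindex_cong[of "\<lambda>s. s + k"])
     (auto simp: bij_def inj_def intro!: surjI[where f = "\<lambda>s. s - k"])

lemma Sum_any_reflect: "Sum_any f = (\<Sum>s. f (- s :: int))"
  by (rule Sum_any.reindex_cong[of uminus]) (auto simp: bij_def inj_def intro: surjI)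

lemma Sum_any_nonneg: "(\<And>s. f s \<ge> (0::int)) \<Longrightarrow> Sum_any f \<ge> 0"
  by (simp add: Sum_any.expand_set sum_nonneg)

lemma flows_0: "flows 0 0 0 x y = (if x = 0 \<and> y = 0 then 1 else 0)"
proof -
  have "flows 0 0 0 x y = (\<Sum>q::int. if q = 0 then (if x = 0 \<and> y = 0 then 1 else 0) else 0)"
    unfolding flows_def by (rule Sum_any.cong) auto
  then show ?thesis by (simp only: Sum_any.delta)
qed

text \<open>In each of the three recursions the added edge is oriented in one of the two ways, which changes
  the net flows at its ends.\<close>

lemma flows_Suc1: "flows (Suc a) b c x y = flows a b c (x - 1) (y + 1) + flows a b c (x + 1) (y - 1)"
  unfolding flows_def
  by (subst Sum_any.distrib[symmetric])
     (simp_all only: finite_walks_mult', auto simp: algebra_simps intro!: Sum_any.cong)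

lemma flows_Suc2: "flows a (Suc b) c x y = flows a b c x (y - 1) + flows a b c x (y + 1)"
  unfolding flows_def
  by (subst Sum_any.distrib[symmetric])
     (simp_all only: finite_walks_mult', auto simp: algebra_simps intro!: Sum_any.cong)

lemma flows_Suc3: "flows a b (Suc c) x y = flows a b c (x - 1) y + flows a b c (x + 1) y"
proof -
  \<comment> \<open>Here the added edge changes the summation variable itself, so the two halves are shifted back.\<close>
  let ?f = "\<lambda>q. walks a (q + x) * walks b (q + x + y)"
  have "flows a b (Suc c) x y = (\<Sum>q. ?f q * walks c (q + 1)) + (\<Sum>q. ?f q * walks c (q - 1))"
    unfolding flows_def
    by (subst Sum_any.distrib[symmetric])
       (simp_all only: finite_walks_mult finite_walks_mult', auto simp: algebra_simps intro!: Sum_any.cong)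
  also have "(\<Sum>q. ?f q * walks c (q + 1)) = flows a b c (x - 1) y"
    unfolding flows_def by (subst Sum_any_shift[of _ "- 1"]) (simp add: algebra_simps)
  also have "(\<Sum>q. ?f q * walks c (q - 1)) = flows a b c (x + 1) y"
    unfolding flows_def by (subst Sum_any_shift[of _ 1]) (simp add: algebra_simps)
  finally show ?thesis .
qed

text \<open>Two increments over the same interval, each zero or of the opposite sign to \<open>s\<close>; the next lemma adds that
  products of nonnegative even unimodal functions behave in the same way.\<close>

lemma walks_step_mult_nonneg:
  "(walks a (s - 1) - walks a (s + 1)) * (walks b (s - 1) - walks b (s + 1)) \<ge> 0"
  using walks_step_sign[of s]
  by (cases "s \<ge> 0") (auto intro: mult_nonneg_nonneg mult_nonpos_nonpos)

lemma walks_mult_step_mult_nonneg: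
  "(walks a (s - 1) - walks a (s + 1)) *
   (walks b (s - 1) * walks c (s - 1) - walks b (s + 1) * walks c (s + 1)) \<ge> 0"
proof (cases "s \<ge> 0")
  case True
  then show ?thesis
    using mult_mono[OF walks_step_sign(1)[OF True, of b] walks_step_sign(1)[OF True, of c]]
    by (intro mult_nonneg_nonneg) (simp_all add: walks_step_sign walks_nonneg)
next
  case False
  then have s: "s \<le> 0" by simp
  then show ?thesis
    using mult_mono[OF walks_step_sign(2)[OF s, of b] walks_step_sign(2)[OF s, of c]]
    by (intro mult_nonpos_nonpos) (simp_all add: walks_step_sign walks_nonneg)
qed

text \<open>Expanding the right-hand side gives four sums. The substitution \<open>s \<mapsto> - s\<close> identifies the two
  unmixed ones with each other and the two mixed ones with each other.\<close>

lemma Sum_any_reflect_polarized: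
  fixes f g :: "int \<Rightarrow> int"
  assumes "\<And>s. u (- s) = u s" "\<And>s. f (- s) = f s" "\<And>s. g (- s) = g s"
    and "finite {s. g s \<noteq> 0}"
  shows "2 * ((\<Sum>s. u s * f (s + 1) * g (s + 1)) - (\<Sum>s. u s * f (s - 1) * g (s + 1)))
    = (\<Sum>s. u s * (f (s - 1) - f (s + 1)) * (g (s - 1) - g (s + 1)))"
proof -
  have fin: "finite {s. h s * g (s + k) \<noteq> 0}" for h k
  proof (rule finite_subset)
    show "{s. h s * g (s + k) \<noteq> 0} \<subseteq> (\<lambda>s. s - k) ` {s. g s \<noteq> 0}"
      by (auto intro!: image_eqI[where x = "_ + k"])
  qed (simp add: assms)
  have fin': "finite {s. h s * g (s - k) \<noteq> 0}" for h k
    using fin[of h "- k"] by simp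
  have neg: "f (- s - 1) = f (s + 1)" "f (- s + 1) = f (s - 1)"
       "g (- s - 1) = g (s + 1)" "g (- s + 1) = g (s - 1)" for s
  proof -
    have "- s - 1 = - (s + 1)" "- s + 1 = - (s - 1)" by simp_all
    then show "f (- s - 1) = f (s + 1)" "f (- s + 1) = f (s - 1)"
       "g (- s - 1) = g (s + 1)" "g (- s + 1) = g (s - 1)" by (simp_all only: assms(2,3))
  qed
  have 1: "(\<Sum>s. u s * f (s - 1) * g (s - 1)) = (\<Sum>s. u s * f (s + 1) * g (s + 1))"
    by (subst Sum_any_reflect) (simp only: neg assms)
  have 2: "(\<Sum>s. u s * f (s + 1) * g (s - 1)) = (\<Sum>s. u s * f (s - 1) * g (s + 1))"
    by (subst Sum_any_reflect) (simp only: neg assms)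
  have "(\<Sum>s. u s * (f (s - 1) - f (s + 1)) * (g (s - 1) - g (s + 1)))
    = (\<Sum>s. (u s * f (s - 1) * g (s - 1) + u s * f (s + 1) * g (s + 1))
        + ((- (u s * f (s + 1))) * g (s - 1) + (- (u s * f (s - 1))) * g (s + 1)))"
    by (rule Sum_any.cong) (simp add: algebra_simps)
  also have "\<dots> = ((\<Sum>s. u s * f (s - 1) * g (s - 1)) + (\<Sum>s. u s * f (s + 1) * g (s + 1)))
     + ((\<Sum>s. (- (u s * f (s + 1))) * g (s - 1)) + (\<Sum>s. (- (u s * f (s - 1))) * g (s + 1)))"
  proof -
    have un: "finite {s. h s + h' s \<noteq> 0}" if "finite {s. h s \<noteq> 0}" "finite {s. h' s \<noteq> 0}" for h h' :: "int \<Rightarrow> int"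
      by (rule finite_subset[OF _ finite_UnI[OF that]]) auto
    show ?thesis
      by (subst Sum_any.distrib; (rule un)?; (rule fin fin')?; (subst Sum_any.distrib; (rule fin fin')?)+; simp)
  qed
  also have "(\<Sum>s. (- (u s * f (s + 1))) * g (s - 1)) = - (\<Sum>s. u s * f (s + 1) * g (s - 1))"
    by (simp add: Sum_any.expand_set sum_negf)
  also have "(\<Sum>s. (- (u s * f (s - 1))) * g (s + 1)) = - (\<Sum>s. u s * f (s - 1) * g (s + 1))"
    by (simp add: Sum_any.expand_set sum_negf)
  finally show ?thesis unfolding 1 2 by simp
qed

text \<open>A balanced orientation count dominates the count with two units sent from vertex \<open>2\<close> to
  vertex \<open>1\<close>. The sides at vertex \<open>3\<close> carry equal flows in both sums, hence enter
  as the single even function \<open>walks b * walks c\<close>.\<close>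

lemma flows_diagonal: "flows a b c (- 2) 2 \<le> flows a b c 0 0"
proof -
  have "flows a b c 0 0 = (\<Sum>s. 1 * walks a (s + 1) * (walks b (s + 1) * walks c (s + 1)))"
    unfolding flows_def by (subst Sum_any_shift[of _ 1]) (simp add: algebra_simps)
  moreover have "flows a b c (- 2) 2 = (\<Sum>s. 1 * walks a (s - 1) * (walks b (s + 1) * walks c (s + 1)))"
    unfolding flows_def by (subst Sum_any_shift[of _ 1]) (simp add: algebra_simps)
  moreover have "0 \<le> (\<Sum>s. 1 * (walks a (s - 1) - walks a (s + 1)) *
      (walks b (s - 1) * walks c (s - 1) - walks b (s + 1) * walks c (s + 1)))"
    by (rule Sum_any_nonneg) (use walks_mult_step_mult_nonneg in simp)
  ultimately show ?thesis
    using Sum_any_reflect_polarized[of "\<lambda>_. 1" "walks a" "\<lambda>s. walks b s * walks c s",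
        OF refl walks_minus _ finite_walks_mult'(2)]
    by simp
qed

text \<open>With the flow through the first side as summation variable \<open>s\<close>, the other two sides carry
  \<open>s + 1, s + 1\<close> in the larger sum, and \<open>s - 1, s + 1\<close> in the smaller one.\<close>

lemma flows_off_diagonal: "flows a b c (- 1) (- 1) \<le> flows a b c (- 1) 1"
proof -
  have "flows a b c (- 1) 1 = (\<Sum>s. walks a s * walks b (s + 1) * walks c (s + 1))"
    unfolding flows_def by (subst Sum_any_shift[of _ 1]) (simp add: algebra_simps)
  moreover have "flows a b c (- 1) (- 1) = (\<Sum>s. walks a s * walks b (s - 1) * walks c (s + 1))"
    unfolding flows_def by (subst Sum_any_shift[of _ 1]) (simp add: algebra_simps)
  moreover have "0 \<le> (\<Sum>s. walks a s * (walks b (s - 1) - walks b (s + 1)) * (walks c (s - 1) - walks c (s + 1)))"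
    by (rule Sum_any_nonneg)
       (metis mult.assoc mult_nonneg_nonneg walks_step_mult_nonneg walks_nonneg)
  ultimately show ?thesis
    using Sum_any_reflect_polarized[of "walks a" "walks b" "walks c",
        OF walks_minus walks_minus walks_minus finite_walks]
    by simp
qed

section \<open>Products of two coefficients of a product of linear forms\<close>

text \<open>A letter is the unordered pair of indices that two copies of one linear form contribute; a
  word records this pair for each of the forms.\<close>

datatype letter = Loop1 | Loop2 | Loop3 | Edge12 | Edge23 | Edge31

lemma UNIV_letter: "UNIV = {Loop1, Loop2, Loop3, Edge12, Edge23, Edge31}"
  by (auto intro: letter.exhaust)

lemma sum_words_Suc:
  "(\<Sum>ts | length ts = Suc n. f ts) =
   (\<Sum>ts | length ts = n. f (Loop1 # ts) + f (Loop2 # ts) + f (Loop3 # ts)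
      + f (Edge12 # ts) + f (Edge23 # ts) + f (Edge31 # ts))"
proof -
  have words: "{ts :: letter list. length ts = Suc n} = (\<lambda>(ts, t). t # ts) ` ({ts. length ts = n} \<times> UNIV)"
    by (force simp: length_Suc_conv image_iff)
  have inj: "inj_on (\<lambda>(ts, t). t # ts) ({ts :: letter list. length ts = n} \<times> UNIV)"
    by (auto simp: inj_on_def)
  have "(\<Sum>ts | length ts = Suc n. f ts) =
      (\<Sum>(ts, t)\<in>{ts. length ts = n} \<times> UNIV. f (t # ts))"
    unfolding words sum.reindex[OF inj] by (simp add: case_prod_unfold)
  also have "\<dots> = (\<Sum>ts | length ts = n. \<Sum>t\<in>UNIV. f (t # ts))"
    by (simp add: sum.cartesian_product)
  finally show ?thesis by (simp add: UNIV_letter add.assoc)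
qed

text \<open>The number of ways to order the pair of every letter in a word so that the first entries contain
  \<open>1, 2, 3\<close> with multiplicities \<open>i, j, k\<close> and the second entries with multiplicities \<open>i', j', k'\<close>. The
  multiplicities are integers, so that lowering them below zero needs no special treatment: the
  count is then zero.\<close>

primrec splittings :: "letter list \<Rightarrow> int \<Rightarrow> int \<Rightarrow> int \<Rightarrow> int \<Rightarrow> int \<Rightarrow> int \<Rightarrow> int" where
  "splittings [] i j k i' j' k' =
     (if i = 0 \<and> j = 0 \<and> k = 0 \<and> i' = 0 \<and> j' = 0 \<and> k' = 0 then 1 else 0)"
| "splittings (t # ts) i j k i' j' k' =
     (case t of
        Loop1 \<Rightarrow> splittings ts (i - 1) j k (i' - 1) j' k'
      | Loop2 \<Rightarrow> splittings ts i (j - 1) k i' (j' - 1) k'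
      | Loop3 \<Rightarrow> splittings ts i j (k - 1) i' j' (k' - 1)
      | Edge12 \<Rightarrow> splittings ts (i - 1) j k i' (j' - 1) k' + splittings ts i (j - 1) k (i' - 1) j' k'
      | Edge23 \<Rightarrow> splittings ts i (j - 1) k i' j' (k' - 1) + splittings ts i j (k - 1) i' (j' - 1) k'
      | Edge31 \<Rightarrow> splittings ts i j (k - 1) (i' - 1) j' k' + splittings ts (i - 1) j k i' j' (k' - 1))"

text \<open>The first three conditions say that the two multidegrees add up to the degrees of the multigraph
  (a loop counts twice). The last one forces the third net flow to be the
  negative of the sum of the other two, which \<open>flows\<close> presupposes.\<close>

lemma splittings_eq_flows:
  "splittings ts i j k i' j' k' =
    (if i + i' = int (2 * count_list ts Loop1 + count_list ts Edge12 + count_list ts Edge31) \<and>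
        j + j' = int (2 * count_list ts Loop2 + count_list ts Edge12 + count_list ts Edge23) \<and>
        k + k' = int (2 * count_list ts Loop3 + count_list ts Edge23 + count_list ts Edge31) \<and>
        i + j + k = i' + j' + k'
     then flows (count_list ts Edge12) (count_list ts Edge23) (count_list ts Edge31) (i - i') (j - j')
     else 0)"
proof (induction ts arbitrary: i j k i' j' k')
  case Nil
  then show ?case by (auto simp: flows_0)
next
  case (Cons t ts)
  show ?case
    by (cases t) (auto simp: Cons.IH flows_Suc1 flows_Suc2 flows_Suc3 algebra_simps)
qed

text \<open>The coefficient of \<open>H\<^sub>1\<^sup>i H\<^sub>2\<^sup>j H\<^sub>3\<^sup>k\<close> in \<open>\<Prod>\<^sub>l\<^sub><\<^sub>n (x\<^sub>l H\<^sub>1 + y\<^sub>l H\<^sub>2 + z\<^sub>l H\<^sub>3)\<close>; see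
  \<open>lookup_prod_linear_forms\<close>.\<close>

primrec form_coeff ::
  "(nat \<Rightarrow> 'a) \<Rightarrow> (nat \<Rightarrow> 'a) \<Rightarrow> (nat \<Rightarrow> 'a) \<Rightarrow> nat \<Rightarrow> int \<Rightarrow> int \<Rightarrow> int \<Rightarrow> 'a::comm_ring_1"
where
  "form_coeff x y z 0 i j k = (if i = 0 \<and> j = 0 \<and> k = 0 then 1 else 0)"
| "form_coeff x y z (Suc n) i j k =
     x n * form_coeff x y z n (i - 1) j k +
     y n * form_coeff x y z n i (j - 1) k +
     z n * form_coeff x y z n i j (k - 1)"

lemma form_coeff_swap12: "form_coeff x y z n i j k = form_coeff y x z n j i k"
  by (induction n arbitrary: i j k) (auto simp: ac_simps)

lemma form_coeff_swap23: "form_coeff x y z n i j k = form_coeff x z y n i k j"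
  by (induction n arbitrary: i j k) (auto simp: ac_simps)

lemma form_coeff_eq_0: "i < 0 \<or> j < 0 \<or> k < 0 \<Longrightarrow> form_coeff x y z n i j k = 0"
  by (induction n arbitrary: i j k) auto

text \<open>The head of a word of length \<open>n + 1\<close> belongs to the form number \<open>n\<close>, the last factor that
  \<open>form_coeff\<close> removes.\<close>

primrec word_weight ::
  "(nat \<Rightarrow> 'a) \<Rightarrow> (nat \<Rightarrow> 'a) \<Rightarrow> (nat \<Rightarrow> 'a) \<Rightarrow> letter list \<Rightarrow> 'a::comm_ring_1"
where
  "word_weight x y z [] = 1"
| "word_weight x y z (t # ts) =
     (let n = length ts in
      case t of
        Loop1 \<Rightarrow> x n * x n
      | Loop2 \<Rightarrow> y n * y n
      | Loop3 \<Rightarrow> z n * z n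
      | Edge12 \<Rightarrow> x n * y n
      | Edge23 \<Rightarrow> y n * z n
      | Edge31 \<Rightarrow> z n * x n) * word_weight x y z ts"

text \<open>Multiplying out the recursions for both coefficients gives nine terms; the six with different
  indices are grouped into three pairs according to the edge of the triangle.\<close>

lemma form_coeff_mult:
  "form_coeff x y z n i j k * form_coeff x y z n i' j' k' =
   (\<Sum>ts | length ts = n. of_int (splittings ts i j k i' j' k') * word_weight x y z ts)"
proof (induction n arbitrary: i j k i' j' k')
  case 0
  then show ?case by simp
next
  case (Suc n)
  let ?E = "form_coeff x y z n"
  have "form_coeff x y z (Suc n) i j k * form_coeff x y z (Suc n) i' j' k' =
      x n * x n * (?E (i - 1) j k * ?E (i' - 1) j' k') +
      y n * y n * (?E i (j - 1) k * ?E i' (j' - 1) k') +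
      z n * z n * (?E i j (k - 1) * ?E i' j' (k' - 1)) +
      x n * y n * (?E (i - 1) j k * ?E i' (j' - 1) k' + ?E i (j - 1) k * ?E (i' - 1) j' k') +
      y n * z n * (?E i (j - 1) k * ?E i' j' (k' - 1) + ?E i j (k - 1) * ?E i' (j' - 1) k') +
      z n * x n * (?E i j (k - 1) * ?E (i' - 1) j' k' + ?E (i - 1) j k * ?E i' j' (k' - 1))"
    by (simp add: algebra_simps)
  also have "\<dots> = (\<Sum>ts | length ts = Suc n. of_int (splittings ts i j k i' j' k') * word_weight x y z ts)"
    unfolding Suc.IH sum_words_Suc
    by (simp add: sum_distrib_left sum.distrib[symmetric] Let_def)
       (rule sum.cong, simp, simp add: algebra_simps)
  finally show ?case .
qed

section \<open>Coefficientwise inequalities\<close>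

definition nonneg_coeffs :: "('v, int) mpoly \<Rightarrow> bool" where
  "nonneg_coeffs p \<longleftrightarrow> (\<forall>m. Poly_Mapping.lookup p m \<ge> 0)"

lemma nonneg_coeffs_of_int: "c \<ge> 0 \<Longrightarrow> nonneg_coeffs (of_int c)"
  by (simp add: nonneg_coeffs_def lookup_of_int when_def)

lemma nonneg_coeffs_Var: "nonneg_coeffs (Var v)"
  by (simp add: nonneg_coeffs_def Var_def lookup_single when_def)

lemma nonneg_coeffs_mult: "nonneg_coeffs p \<Longrightarrow> nonneg_coeffs q \<Longrightarrow> nonneg_coeffs (p * q)"
  unfolding nonneg_coeffs_def lookup_mult
  by (auto intro!: Sum_any_nonneg mult_nonneg_nonneg simp: when_def)

lemma nonneg_coeffs_sum: "(\<And>s. s \<in> S \<Longrightarrow> nonneg_coeffs (f s)) \<Longrightarrow> nonneg_coeffs (sum f S)"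
  unfolding nonneg_coeffs_def by (simp add: lookup_sum sum_nonneg)

lemma nonneg_coeffs_word_weight:
  assumes "\<And>n. nonneg_coeffs (x n)" "\<And>n. nonneg_coeffs (y n)" "\<And>n. nonneg_coeffs (z n)"
  shows "nonneg_coeffs (word_weight x y z ts)"
proof (induction ts)
  case Nil
  show ?case using nonneg_coeffs_of_int[of 1] by simp
next
  case (Cons t ts)
  then show ?case
    by (cases t) (auto simp: Let_def intro!: nonneg_coeffs_mult assms)
qed

text \<open>Different words may have the same weight; this does no harm, because the comparison is made
  word by word before terms are collected.\<close>

lemma nonneg_coeffs_form_coeff_mult_diff:
  assumes "\<And>n. nonneg_coeffs (x n)" "\<And>n. nonneg_coeffs (y n)" "\<And>n. nonneg_coeffs (z n)"
    and "\<And>ts. splittings ts i j k i' j' k' \<le> splittings ts l m n l' m' n'"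
  shows "nonneg_coeffs (form_coeff x y z N l m n * form_coeff x y z N l' m' n'
    - form_coeff x y z N i j k * form_coeff x y z N i' j' k')"
proof -
  have "form_coeff x y z N l m n * form_coeff x y z N l' m' n'
      - form_coeff x y z N i j k * form_coeff x y z N i' j' k'
    = (\<Sum>ts | length ts = N. of_int (splittings ts l m n l' m' n' - splittings ts i j k i' j' k')
        * word_weight x y z ts)"
    by (simp add: form_coeff_mult sum_subtractf left_diff_distrib)
  then show ?thesis
    using assms
    by (auto intro!: nonneg_coeffs_sum nonneg_coeffs_mult nonneg_coeffs_of_int
        nonneg_coeffs_word_weight simp del: of_int_diff)
qed

lemma form_coeff_diagonal:
  assumes "\<And>n. nonneg_coeffs (x n)" "\<And>n. nonneg_coeffs (y n)" "\<And>n. nonneg_coeffs (z n)"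
  shows "nonneg_coeffs (form_coeff x y z n (i - 1) (j - 1) k * form_coeff x y z n (i - 1) (j - 1) k
    - form_coeff x y z n (i - 2) j k * form_coeff x y z n i (j - 2) k)"
  using assms
proof (rule nonneg_coeffs_form_coeff_mult_diff)
  show "splittings ts (i - 2) j k i (j - 2) k \<le> splittings ts (i - 1) (j - 1) k (i - 1) (j - 1) k" for ts
    using flows_diagonal by (auto simp: splittings_eq_flows)
qed

lemma form_coeff_off_diagonal:
  assumes "\<And>n. nonneg_coeffs (x n)" "\<And>n. nonneg_coeffs (y n)" "\<And>n. nonneg_coeffs (z n)"
  shows "nonneg_coeffs (form_coeff x y z n (i - 1) j (k - 1) * form_coeff x y z n i (j - 1) (k - 1)
    - form_coeff x y z n (i - 1) (j - 1) k * form_coeff x y z n i j (k - 2))"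
  using assms
proof (rule nonneg_coeffs_form_coeff_mult_diff)
  show "splittings ts (i - 1) (j - 1) k i j (k - 2) \<le> splittings ts (i - 1) j (k - 1) i (j - 1) (k - 1)" for ts
    using flows_off_diagonal by (auto simp: splittings_eq_flows)
qed

section \<open>The Hessian of the cubic form\<close>

lemma lookup_single_Var_mult:
  fixes a :: "'a::comm_semiring_1" and p :: "('v, 'a) mpoly"
  shows "Poly_Mapping.lookup (Poly_Mapping.single (Poly_Mapping.single v 1) a * p) m =
    (if Poly_Mapping.lookup m v > 0
     then a * Poly_Mapping.lookup p (m - Poly_Mapping.single v 1) else 0)"
proof -
  let ?s = "Poly_Mapping.single v (1::nat)"
  have "Poly_Mapping.lookup (Poly_Mapping.single ?s a * p) m =
      (\<Sum>l. a * (\<Sum>q. Poly_Mapping.lookup p q when m = l + q) when l = ?s)"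
    unfolding lookup_mult by (rule Sum_any.cong) (auto simp: lookup_single when_def)
  also have "\<dots> = a * (\<Sum>q. Poly_Mapping.lookup p q when m = ?s + q)"
    by simp
  also have "(\<Sum>q. Poly_Mapping.lookup p q when m = ?s + q) =
      (if Poly_Mapping.lookup m v > 0 then Poly_Mapping.lookup p (m - ?s) else 0)"
  proof (cases "Poly_Mapping.lookup m v > 0")
    case True
    then have "m = ?s + (m - ?s)"
      by (intro poly_mapping_eqI) (auto simp: lookup_add lookup_minus lookup_single when_def)
    then have "m = ?s + q \<longleftrightarrow> q = m - ?s" for q
      by (metis add_diff_cancel_left')
    then show ?thesis using True by simp
  next
    case False
    then have "m \<noteq> ?s + q" for q
      by (auto simp: lookup_add)
    then show ?thesis using False by simp
  qed
  finally show ?thesis by (simp add: mult.commute)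
qed

lemma lookup_prod_linear_forms:
  "Poly_Mapping.lookup
     (\<Prod>l<n. Const (x l) * Var 1 + Const (y l) * Var 2 + Const (z l) * Var (3::nat))
     (Poly_Mapping.single 1 i + Poly_Mapping.single 2 j + Poly_Mapping.single 3 k)
   = form_coeff x y z n (int i) (int j) (int k)"
proof (induction n arbitrary: i j k)
  case 0
  have "(0 = Poly_Mapping.single 1 i + Poly_Mapping.single 2 j + Poly_Mapping.single (3::nat) k)
      \<longleftrightarrow> i = 0 \<and> j = 0 \<and> k = 0"
  proof
    assume 0: "0 = Poly_Mapping.single 1 i + Poly_Mapping.single 2 j + Poly_Mapping.single (3::nat) k"
    show "i = 0 \<and> j = 0 \<and> k = 0"
      using arg_cong[OF 0, of "\<lambda>m. Poly_Mapping.lookup m 1"]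
        arg_cong[OF 0, of "\<lambda>m. Poly_Mapping.lookup m 2"]
        arg_cong[OF 0, of "\<lambda>m. Poly_Mapping.lookup m 3"]
      by (simp add: lookup_add lookup_single when_def)
  qed simp
  then show ?case by (auto simp: lookup_one when_def)
next
  case (Suc n)
  let ?m = "\<lambda>i j k. Poly_Mapping.single 1 i + Poly_Mapping.single 2 j + Poly_Mapping.single (3::nat) k"
  define Q where "Q = (\<Prod>l<n. Const (x l) * Var 1 + Const (y l) * Var 2 + Const (z l) * Var (3::nat))"
  have lower:
    "?m i j k - Poly_Mapping.single 1 1 = ?m (i - 1) j k"
    "?m i j k - Poly_Mapping.single 2 1 = ?m i (j - 1) k"
    "?m i j k - Poly_Mapping.single 3 1 = ?m i j (k - 1)"
    by (intro poly_mapping_eqI; simp add: lookup_add lookup_minus lookup_single when_def)+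
  have Const_Var: "Const a * Var v = Poly_Mapping.single (Poly_Mapping.single v 1) a" for a :: 'a and v :: nat
    by (simp add: Const_def Var_def mult_single)
  have "(\<Prod>l<Suc n. Const (x l) * Var 1 + Const (y l) * Var 2 + Const (z l) * Var (3::nat)) =
      Const (x n) * Var 1 * Q + Const (y n) * Var 2 * Q + Const (z n) * Var 3 * Q"
    by (simp add: Q_def algebra_simps)
  also have "Poly_Mapping.lookup \<dots> (?m i j k) = form_coeff x y z (Suc n) (int i) (int j) (int k)"
    unfolding Const_Var lookup_add lookup_single_Var_mult lower Suc.IH[folded Q_def]
    by (auto simp: lookup_add lookup_single when_def of_nat_diff form_coeff_eq_0)
  finally show ?case .
qed

text \<open>The coefficients of \<open>H\<^sub>i\<close> in an infinite list of linear forms: first the \<open>r\<close> given ones, with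
  coefficients named by \<open>c\<close>, then copies of \<open>x\<^sub>1 H\<^sub>1 + x\<^sub>2 H\<^sub>2 + x\<^sub>3 H\<^sub>3\<close>. With the copies at the end,
  \<open>form_coeff\<close> removes them first, which suits the induction on their number.\<close>

definition weight :: "nat \<Rightarrow> (nat \<Rightarrow> indet) \<Rightarrow> nat \<Rightarrow> nat \<Rightarrow> (indet, int) mpoly" where
  "weight r c i l = (if l < r then Var (c (Suc l)) else Var (X i))"

abbreviation P_coeff :: "nat \<Rightarrow> nat \<Rightarrow> int \<Rightarrow> int \<Rightarrow> int \<Rightarrow> (indet, int) mpoly" where
  "P_coeff r \<equiv> form_coeff (weight r A 1) (weight r B 2) (weight r C 3)"

lemma F_poly_eq_form_coeff: "F_poly r d1 d2 d3 = P_coeff r (r + 3) (int d1) (int d2) (int d3)"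
proof -
  let ?l = "\<lambda>l. Const (weight r A 1 l) * Var 1 + Const (weight r B 2 l) * Var 2 + Const (weight r C 3 l) * Var (3::nat)"
  have "P_poly r = (\<Prod>l<r + 3. ?l l)"
    by (simp add: P_poly_def weight_def numeral_3_eq_3 prod.atLeast1_atMost_eq mult_ac)
  then show ?thesis
    by (simp only: F_poly_def lookup_prod_linear_forms)
qed

lemma lookup_partial_deriv:
  "Poly_Mapping.lookup (partial_deriv v p) m =
     of_nat (Suc (Poly_Mapping.lookup m v)) * Poly_Mapping.lookup p (m + Poly_Mapping.single v 1)"
proof -
  let ?s = "Poly_Mapping.single v (1::nat)"
  let ?f = "\<lambda>k. of_nat (Poly_Mapping.lookup k v) * Poly_Mapping.lookup p k"
  have eq: "k - ?s = m \<longleftrightarrow> k = m + ?s" if "Poly_Mapping.lookup k v > 0" for k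
  proof
    assume "k - ?s = m"
    then show "k = m + ?s" using that
      by (intro poly_mapping_eqI) (auto simp: lookup_add lookup_minus lookup_single when_def)
  qed simp
  have "Poly_Mapping.lookup (partial_deriv v p) m = (\<Sum>k\<in>Poly_Mapping.keys p. if k - ?s = m then ?f k else 0)"
    by (simp add: partial_deriv_def lookup_sum lookup_single when_def)
  also have "\<dots> = (\<Sum>k\<in>Poly_Mapping.keys p. if k = m + ?s then ?f k else 0)"
  proof (rule sum.cong)
    show "(if k - ?s = m then ?f k else 0) = (if k = m + ?s then ?f k else 0)" for k
      by (cases "Poly_Mapping.lookup k v > 0") (simp_all only: eq, simp)
  qed simp
  also have "\<dots> = ?f (m + ?s)"
    by (simp add: in_keys_iff)
  finally show ?thesis by (simp add: lookup_add)
qed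

lemma partial_deriv_add: "partial_deriv v (p + q) = partial_deriv v p + partial_deriv v q"
  by (rule poly_mapping_eqI) (simp add: lookup_partial_deriv lookup_add algebra_simps)

lemma partial_deriv_0 [simp]: "partial_deriv v 0 = 0"
  by (rule poly_mapping_eqI) (simp add: lookup_partial_deriv)

lemma partial_deriv_1 [simp]: "partial_deriv v 1 = 0"
proof (rule poly_mapping_eqI)
  fix m :: "'a \<Rightarrow>\<^sub>0 nat"
  have "m + Poly_Mapping.single v 1 \<noteq> 0"
    by (metis lookup_add lookup_single_eq lookup_zero add_is_0 one_neq_zero)
  then show "Poly_Mapping.lookup (partial_deriv v 1) m = Poly_Mapping.lookup (0 :: ('a, 'b) mpoly) m"
    by (simp add: lookup_partial_deriv lookup_one when_def)
qed

lemma partial_deriv_Var_mult: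
  "partial_deriv v (Var u * p) = of_bool (u = v) * p + Var u * partial_deriv v p"
proof (rule poly_mapping_eqI)
  fix m
  have swap: "m + Poly_Mapping.single v 1 - Poly_Mapping.single u 1 =
      m - Poly_Mapping.single u 1 + Poly_Mapping.single v (1::nat)"
    if "u = v \<longrightarrow> Poly_Mapping.lookup m v > 0"
    using that
    by (intro poly_mapping_eqI) (auto simp: lookup_add lookup_minus lookup_single when_def)
  show "Poly_Mapping.lookup (partial_deriv v (Var u * p)) m =
      Poly_Mapping.lookup (of_bool (u = v) * p + Var u * partial_deriv v p) m"
  proof (cases "u = v")
    case True
    then show ?thesis
      using swap
      unfolding lookup_partial_deriv Var_def lookup_single_Var_mult lookup_add
      by (auto simp: lookup_minus algebra_simps)
  next
    case False
    then show ?thesis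
      using swap
      unfolding lookup_partial_deriv Var_def lookup_single_Var_mult lookup_add
      by (auto simp: lookup_minus lookup_single when_def)
  qed
qed

lemma partial_deriv_numeral_mult:
  "partial_deriv v (numeral c * p) = numeral c * partial_deriv v p"
proof -
  have "partial_deriv v (of_nat n * p) = of_nat n * partial_deriv v p" for n
    by (induction n) (simp_all add: distrib_right partial_deriv_add)
  from this[of "numeral c"] show ?thesis by simp
qed

lemma weight_less: "l < r \<Longrightarrow> weight r c i l = Var (c (Suc l))"
  and weight_ge: "r \<le> l \<Longrightarrow> weight r c i l = Var (X i)"
  by (simp_all add: weight_def)

lemma partial_deriv_P_coeff_0:
  "n \<le> r \<Longrightarrow> partial_deriv (X c) (P_coeff r n i j k) = 0"
  by (induction n arbitrary: i j k)
     (simp_all add: partial_deriv_add partial_deriv_Var_mult weight_less)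

lemma partial_deriv_P_coeff_Suc:
  assumes "r \<le> n" "c \<in> {1, 2, 3}"
  shows "partial_deriv (X c) (P_coeff r (Suc n) i j k) =
    P_coeff r n (i - of_bool (c = 1)) (j - of_bool (c = 2)) (k - of_bool (c = 3)) +
    (Var (X 1) * partial_deriv (X c) (P_coeff r n (i - 1) j k) +
     Var (X 2) * partial_deriv (X c) (P_coeff r n i (j - 1) k) +
     Var (X 3) * partial_deriv (X c) (P_coeff r n i j (k - 1)))"
  using assms
  by (elim insertE) (simp_all add: partial_deriv_add partial_deriv_Var_mult weight_ge)

text \<open>Differentiation removes one of the \<open>n + 1\<close> equal factors, and all choices contribute the same.
  In the induction, the recursion for the coefficient is differentiated, the hypothesis is applied to
  its three terms, and the recursion is read backwards.\<close>

lemma partial_deriv_P_coeff: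
  assumes c: "c \<in> {1, 2, 3}"
  shows "partial_deriv (X c) (P_coeff r (Suc (r + n)) i j k) =
    of_nat (Suc n) * P_coeff r (r + n)
      (i - of_bool (c = 1)) (j - of_bool (c = 2)) (k - of_bool (c = 3))"
proof (induction n arbitrary: i j k)
  case 0
  show ?case
    by (simp only: add_0_right partial_deriv_P_coeff_Suc[OF le_refl c]
        partial_deriv_P_coeff_0[OF le_refl]) simp
next
  case (Suc n)
  let ?i = "i - of_bool (c = 1)" and ?j = "j - of_bool (c = 2)" and ?k = "k - of_bool (c = 3)"
  let ?E = "P_coeff r (r + n)"
  have swap: "i - 1 - of_bool (c = 1) = ?i - 1" "j - 1 - of_bool (c = 2) = ?j - 1"
      "k - 1 - of_bool (c = 3) = ?k - 1"
    by simp_all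
  have "P_coeff r (Suc (r + n)) ?i ?j ?k =
      Var (X 1) * ?E (?i - 1) ?j ?k + Var (X 2) * ?E ?i (?j - 1) ?k + Var (X 3) * ?E ?i ?j (?k - 1)"
    by (simp add: weight_ge)
  moreover have "partial_deriv (X c) (P_coeff r (Suc (Suc (r + n))) i j k) =
      P_coeff r (Suc (r + n)) ?i ?j ?k +
      of_nat (Suc n) * (Var (X 1) * ?E (?i - 1) ?j ?k + Var (X 2) * ?E ?i (?j - 1) ?k
        + Var (X 3) * ?E ?i ?j (?k - 1))"
    by (subst partial_deriv_P_coeff_Suc[OF _ c], simp)
       (simp only: Suc.IH swap distrib_left mult.left_commute[of "Var _" "of_nat (Suc n)"])
  ultimately have "partial_deriv (X c) (P_coeff r (Suc (Suc (r + n))) i j k) =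
      of_nat (Suc (Suc n)) * P_coeff r (Suc (r + n)) ?i ?j ?k"
    by (simp only: of_nat_Suc[of "Suc n"] distrib_right mult_1_left)
  then show ?case by (simp only: add_Suc_right)
qed

lemma second_partial_deriv_F_poly:
  assumes "p \<in> {1, 2, 3}" "q \<in> {1, 2, 3}"
  shows "partial_deriv (X p) (partial_deriv (X q) (F_poly r d1 d2 d3)) =
    6 * P_coeff r (r + 1)
      (int d1 - of_bool (p = 1) - of_bool (q = 1))
      (int d2 - of_bool (p = 2) - of_bool (q = 2))
      (int d3 - of_bool (p = 3) - of_bool (q = 3))"
proof -
  have "partial_deriv (X q) (F_poly r d1 d2 d3) = 3 * P_coeff r (r + 2)
      (int d1 - of_bool (q = 1)) (int d2 - of_bool (q = 2)) (int d3 - of_bool (q = 3))"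
    using partial_deriv_P_coeff[OF assms(2), of r 2]
    by (simp add: F_poly_eq_form_coeff numeral_3_eq_3 del: form_coeff.simps)
  moreover have "partial_deriv (X p) (P_coeff r (r + 2) i j k) = 2 * P_coeff r (r + 1)
      (i - of_bool (p = 1)) (j - of_bool (p = 2)) (k - of_bool (p = 3))" for i j k
    using partial_deriv_P_coeff[OF assms(1), of r 1]
    by (simp del: form_coeff.simps)
  ultimately show ?thesis
    by (simp add: partial_deriv_numeral_mult algebra_simps del: form_coeff.simps)
qed

lemma det_2x2:
  assumes "M \<in> carrier_mat 2 2"
  shows "det M = M $$ (0, 0) * M $$ (1, 1) - M $$ (0, 1) * M $$ (1, 0)"
proof -
  have minor: "mat_delete M i j \<in> carrier_mat 1 1" for i j
    using mat_delete_carrier[OF assms] by simp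
  have "cofactor M 0 0 = M $$ (1, 1)" "cofactor M 0 1 = - M $$ (1, 0)"
    unfolding cofactor_def det_single[OF minor] using assms by (simp_all add: mat_delete_def)
  then show ?thesis
    using laplace_expansion_row[OF assms, of 0] by (simp add: numeral_2_eq_2)
qed


section \<open>The signs of the cofactors\<close>

lemma cofactor_3x3:
  fixes M :: "'a::comm_ring_1 mat"
  assumes "M \<in> carrier_mat 3 3"
  shows "cofactor M 0 0 = M $$ (1, 1) * M $$ (2, 2) - M $$ (1, 2) * M $$ (2, 1)"
    and "cofactor M 1 1 = M $$ (0, 0) * M $$ (2, 2) - M $$ (0, 2) * M $$ (2, 0)"
    and "cofactor M 2 2 = M $$ (0, 0) * M $$ (1, 1) - M $$ (0, 1) * M $$ (1, 0)"
    and "cofactor M 0 1 = M $$ (1, 2) * M $$ (2, 0) - M $$ (1, 0) * M $$ (2, 2)"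
    and "cofactor M 1 0 = M $$ (0, 2) * M $$ (2, 1) - M $$ (0, 1) * M $$ (2, 2)"
    and "cofactor M 0 2 = M $$ (1, 0) * M $$ (2, 1) - M $$ (1, 1) * M $$ (2, 0)"
    and "cofactor M 2 0 = M $$ (0, 1) * M $$ (1, 2) - M $$ (0, 2) * M $$ (1, 1)"
    and "cofactor M 1 2 = M $$ (0, 1) * M $$ (2, 0) - M $$ (0, 0) * M $$ (2, 1)"
    and "cofactor M 2 1 = M $$ (0, 2) * M $$ (1, 0) - M $$ (0, 0) * M $$ (1, 2)"
  unfolding cofactor_def det_2x2[OF mat_delete_carrier[OF assms, simplified]] using assms
  by (auto simp: mat_delete_def numeral_2_eq_2 numeral_3_eq_3)

lemma only_positive_coeffs_36_mult:
  "nonneg_coeffs p \<Longrightarrow> only_positive_coeffs (36 * p)"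
  using nonneg_coeffs_mult[OF nonneg_coeffs_of_int[of 36], of p]
  by (auto simp: only_positive_coeffs_def nonneg_coeffs_def in_keys_iff order_less_le)

lemma only_negative_coeffs_36_mult:
  assumes "nonneg_coeffs (q - p)"
  shows "only_negative_coeffs (36 * (p - q))"
proof -
  have "36 * (p - q) = - (36 * (q - p))" by simp
  then show ?thesis
    using only_positive_coeffs_36_mult[OF assms]
    by (auto simp: only_negative_coeffs_def only_positive_coeffs_def in_keys_iff
        simp del: right_diff_distrib_numeral)
qed

theorem theorem3p1:
  fixes r d1 d2 d3 :: nat
  assumes "d1 > 0" "d2 > 0" "d3 > 0" "d1 + d2 + d3 = r + 3"
  shows "(\<forall>p\<in>{1..3}. only_negative_coeffs (hessian_cofactor (F_poly r d1 d2 d3) p p)) \<and>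
         (\<forall>p\<in>{1..3}. \<forall>q\<in>{1..3}. p \<noteq> q \<longrightarrow>
            only_positive_coeffs (hessian_cofactor (F_poly r d1 d2 d3) p q))"
proof -
  let ?F = "F_poly r d1 d2 d3"
  let ?M = "hessian ?F"
  define E where "E a b c = P_coeff r (Suc r) (int d1 - a) (int d2 - b) (int d3 - c)" for a b c
  have M: "?M \<in> carrier_mat 3 3"
    by (simp add: hessian_def)
  \<comment> \<open>The arguments of \<open>E\<close> count how often each \<open>d\<^sub>i\<close> is lowered.\<close>
  have entry:
    "?M $$ (0, 0) = 6 * E 2 0 0" "?M $$ (1, 1) = 6 * E 0 2 0" "?M $$ (2, 2) = 6 * E 0 0 2"
    "?M $$ (0, 1) = 6 * E 1 1 0" "?M $$ (1, 0) = 6 * E 1 1 0"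
    "?M $$ (0, 2) = 6 * E 1 0 1" "?M $$ (2, 0) = 6 * E 1 0 1"
    "?M $$ (1, 2) = 6 * E 0 1 1" "?M $$ (2, 1) = 6 * E 0 1 1"
    by (simp_all add: hessian_def second_partial_deriv_F_poly E_def del: form_coeff.simps)
  have w: "nonneg_coeffs (weight r c i l)" for c i l
    by (simp add: weight_def nonneg_coeffs_Var)
  let ?x = "weight r A 1" and ?y = "weight r B 2" and ?z = "weight r C 3"
  let ?i = "int d1" and ?j = "int d2" and ?k = "int d3"
  \<comment> \<open>The inequalities single out the third variable. Listing the variables in another order gives
    the remaining cases; the rules below restore the standard order.\<close>
  note swap = E_def diff_0_right form_coeff_swap23[of ?x ?z ?y] form_coeff_swap23[of ?y ?z ?x]
    form_coeff_swap12[of ?y ?x ?z]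
  have diagonal:
    "nonneg_coeffs (E 1 1 0 * E 1 1 0 - E 2 0 0 * E 0 2 0)"
    "nonneg_coeffs (E 1 0 1 * E 1 0 1 - E 2 0 0 * E 0 0 2)"
    "nonneg_coeffs (E 0 1 1 * E 0 1 1 - E 0 2 0 * E 0 0 2)"
    using form_coeff_diagonal[of ?x ?y ?z "Suc r" ?i ?j ?k, OF w w w]
      form_coeff_diagonal[of ?x ?z ?y "Suc r" ?i ?k ?j, OF w w w]
      form_coeff_diagonal[of ?y ?z ?x "Suc r" ?j ?k ?i, OF w w w]
    by (simp_all only: swap)
  have off_diagonal:
    "nonneg_coeffs (E 1 0 1 * E 0 1 1 - E 1 1 0 * E 0 0 2)"
    "nonneg_coeffs (E 1 1 0 * E 0 1 1 - E 1 0 1 * E 0 2 0)"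
    "nonneg_coeffs (E 1 1 0 * E 1 0 1 - E 0 1 1 * E 2 0 0)"
    using form_coeff_off_diagonal[of ?x ?y ?z "Suc r" ?i ?j ?k, OF w w w]
      form_coeff_off_diagonal[of ?x ?z ?y "Suc r" ?i ?k ?j, OF w w w]
      form_coeff_off_diagonal[of ?y ?z ?x "Suc r" ?j ?k ?i, OF w w w]
    by (simp_all only: swap)
  have cofactors:
    "hessian_cofactor ?F 1 1 = 36 * (E 0 2 0 * E 0 0 2 - E 0 1 1 * E 0 1 1)"
    "hessian_cofactor ?F 2 2 = 36 * (E 2 0 0 * E 0 0 2 - E 1 0 1 * E 1 0 1)"
    "hessian_cofactor ?F 3 3 = 36 * (E 2 0 0 * E 0 2 0 - E 1 1 0 * E 1 1 0)"
    "hessian_cofactor ?F 1 2 = 36 * (E 1 0 1 * E 0 1 1 - E 1 1 0 * E 0 0 2)"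
    "hessian_cofactor ?F 2 1 = 36 * (E 1 0 1 * E 0 1 1 - E 1 1 0 * E 0 0 2)"
    "hessian_cofactor ?F 1 3 = 36 * (E 1 1 0 * E 0 1 1 - E 1 0 1 * E 0 2 0)"
    "hessian_cofactor ?F 3 1 = 36 * (E 1 1 0 * E 0 1 1 - E 1 0 1 * E 0 2 0)"
    "hessian_cofactor ?F 2 3 = 36 * (E 1 1 0 * E 1 0 1 - E 0 1 1 * E 2 0 0)"
    "hessian_cofactor ?F 3 2 = 36 * (E 1 1 0 * E 1 0 1 - E 0 1 1 * E 2 0 0)"
    using cofactor_3x3[OF M] by (simp_all add: hessian_cofactor_def entry[simplified] algebra_simps)
  have "{1..3} = {1, 2, 3 :: nat}" by auto
  moreover have "\<forall>p\<in>{1, 2, 3}. only_negative_coeffs (hessian_cofactor ?F p p)"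
    using diagonal[THEN only_negative_coeffs_36_mult] by (simp add: cofactors[simplified])
  moreover have "\<forall>p\<in>{1, 2, 3}. \<forall>q\<in>{1, 2, 3}. p \<noteq> q \<longrightarrow> only_positive_coeffs (hessian_cofactor ?F p q)"
    using off_diagonal[THEN only_positive_coeffs_36_mult] by (simp add: cofactors[simplified])
  ultimately show ?thesis by simp
qed

end
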